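(* Let $F,G\colon\mathbb{R}^n\times\mathbb{R}^p\rightrightarrows\mathbb{R}^q$ be set-valued mappings with convex graphs, let $$S(x):=\{y\in\mathbb{R}^p : 0\in F(x,y)+G(x,y)\},\quad x\in\mathbb{R}^n,$$ and let $(\bar{x},\bar{y})\in\mathrm{gph}(S)$. Suppose that $$\mathrm{ri}(\mathrm{gph}(F))\cap\mathrm{ri}(\mathrm{gph}(-G))\neq\emptyset.$$ Then for every $\bar{z}\in F(\bar{x},\bar{y})\cap[-G(\bar{x},\bar{y})]$ and every $v\in\mathbb{R}^p$ we have $$D^*S(\bar{x},\bar{y})(v)=\bigcup_{w\in\mathbb{R}^q}\big\{u\in\mathbb{R}^n : (u,-v)\in D^*F((\bar{x},\bar{y}),\bar{z})(w)+D^*G((\bar{x},\bar{y}),-\bar{z})(w)\big\}.$$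
   Context: A set-valued mapping $F\colon\mathbb{R}^m\rightrightarrows\mathbb{R}^q$ assigns to each $x$ a set $F(x)\subset\mathbb{R}^q$ (possibly empty); $\mathrm{gph}(F):=\{(x,z) : z\in F(x)\}$. $-G$ is the mapping $(x,y)\mapsto -G(x,y)=\{-z : z\in G(x,y)\}$, so $\mathrm{gph}(-G)=\{(x,y,-z) : z\in G(x,y)\}$. For a convex set $\Omega$ and $\bar{x}\in\Omega$, the normal cone is $N(\bar{x};\Omega):=\{v : \langle v,x-\bar{x}\rangle\le 0\text{ for all }x\in\Omega\}$. The coderivative of a mapping $F\colon\mathbb{R}^m\rightrightarrows\mathbb{R}^q$ at $(\bar{x},\bar{z})\in\mathrm{gph}(F)$ is $D^*F(\bar{x},\bar{z})(w):=\{u\in\mathbb{R}^m : (u,-w)\in N((\bar{x},\bar{z});\mathrm{gph}(F))\}$, $w\in\mathbb{R}^q$ (for $F,G$ above, $\mathbb{R}^m=\mathbb{R}^n\times\mathbb{R}^p$). The relative interior $\mathrm{ri}(\Omega)$ of a convex set $\Omega$ is the set of $x\in\Omega$ for which there is $\gamma>0$ with $\mathbb{B}(x;\gamma)\cap\mathrm{aff}(\Omega)\subset\Omega$ (closed ball, affine hull). Sums of sets are Minkowski sums. *)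

theory Defs
  imports "HOL-Analysis.Analysis" "HOL-Library.Set_Algebras"
begin

text \<open>A set-valued mapping from \<open>'a\<close> to \<open>'b\<close> is a function \<open>'a \<Rightarrow> 'b set\<close>; empty values are
  allowed. Sums of sets are the Minkowski sums of \<^theory>\<open>HOL-Library.Set_Algebras\<close>.\<close>

definition gph :: "('a \<Rightarrow> 'b set) \<Rightarrow> ('a \<times> 'b) set" where
  "gph F = {(x, z). z \<in> F x}"

text \<open>Unary minus on sets is the complement in HOL, hence the image under \<^const>\<open>uminus\<close>.\<close>

definition neg_map :: "('a \<Rightarrow> 'b::ab_group_add set) \<Rightarrow> 'a \<Rightarrow> 'b set" where
  "neg_map G x = uminus ` G x"

text \<open>Only meaningful for convex \<open>\<Omega>\<close> and \<open>xbar \<in> \<Omega>\<close>.\<close>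

definition normal_cone :: "'a::real_inner \<Rightarrow> 'a set \<Rightarrow> 'a set" where
  "normal_cone xbar \<Omega> = {v. \<forall>x\<in>\<Omega>. inner v (x - xbar) \<le> 0}"

text \<open>Only meaningful for \<open>F\<close> with convex graph and \<open>(xbar, zbar) \<in> gph F\<close>.\<close>

definition coderivative ::
  "('a::real_inner \<Rightarrow> 'b::real_inner set) \<Rightarrow> 'a \<times> 'b \<Rightarrow> 'b \<Rightarrow> 'a set" where
  "coderivative F pbar w = {u. (u, - w) \<in> normal_cone pbar (gph F)}"

definition solution_map ::
  "('a \<times> 'b \<Rightarrow> 'c::ab_group_add set) \<Rightarrow> ('a \<times> 'b \<Rightarrow> 'c set) \<Rightarrow> 'a \<Rightarrow> 'b set" where
  "solution_map F G x = {y. 0 \<in> F (x, y) + G (x, y)}"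

end

theory Submission
  imports Defs
begin

text \<open>The graph of the solution map is the projection to the \<open>(x, y)\<close>-space of the intersection of
  \<open>gph F\<close> and \<open>gph (-G)\<close>. Along the projection a normal of \<open>gph S\<close> becomes a normal of
  the intersection whose \<open>z\<close>-component vanishes, whatever point \<open>zbar\<close> above \<open>(xbar, ybar)\<close> is chosen
  (lemma \<open>normal_cone_fst_image\<close>). The relative interior condition lets such a normal be split
  into a normal \<open>(p, -w)\<close> of \<open>gph F\<close> and a normal \<open>(r, w)\<close> of \<open>gph (-G)\<close> (lemma
  \<open>normal_cone_Int\<close>); the two \<open>z\<close>-components cancel, which is why \<open>F\<close> and \<open>G\<close> share the same
  multiplier \<open>w\<close>. Reflecting the second normal in the \<open>z\<close>-direction turns it into a normal of
  \<open>gph G\<close> and yields the two coderivatives.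

  The split itself is a proper separation argument. For a normal \<open>v\<close> of \<open>A \<inter> B\<close> at \<open>x\<close>, the convex set
  of all pairs \<open>(a - b, t)\<close> with \<open>a \<in> A\<close>, \<open>b \<in> B\<close>, \<open>t \<le> v \<bullet> a\<close> has \<open>(0, v \<bullet> x)\<close> outside its
  relative interior. A hyperplane supporting it there cannot be vertical, because the relative interiors
  of \<open>A\<close> and \<open>B\<close> meet, and its slope gives the decomposition of \<open>v\<close>.\<close>

text \<open>A segment of the set that ends in a relatively interior maximizer can be prolonged beyond it,
  where a nonconstant functional would exceed its maximum.\<close>

lemma inner_constant_if_max_at_rel_interior:
  fixes A :: "'a::euclidean_space set"
  assumes "convex A" "c \<in> rel_interior A" and max: "\<And>a. a \<in> A \<Longrightarrow> p \<bullet> a \<le> p \<bullet> c" and "a \<in> A"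
  shows "p \<bullet> a = p \<bullet> c"
proof -
  obtain e where e: "e > 1" "(1 - e) *\<^sub>R a + e *\<^sub>R c \<in> A"
    using convex_rel_interior_if2[OF assms(1,2)] hull_inc[OF \<open>a \<in> A\<close>] by blast
  have "(1 - e) * (p \<bullet> a) + e * (p \<bullet> c) \<le> p \<bullet> c"
    using max[OF e(2)] by (simp add: inner_add_right)
  then have "(e - 1) * (p \<bullet> c - p \<bullet> a) \<le> 0"
    by (simp add: algebra_simps)
  then have "p \<bullet> c \<le> p \<bullet> a"
    using e(1) by (simp add: mult_le_0_iff)
  then show ?thesis
    using max[OF \<open>a \<in> A\<close>] by simp
qed

text \<open>The nontrivial half of the intersection rule: separation in the product with the real line.\<close>

lemma normal_cone_Int_subset:
  fixes A B :: "'a::euclidean_space set"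
  assumes "convex A" "convex B" and ri: "rel_interior A \<inter> rel_interior B \<noteq> {}"
    and x: "x \<in> A \<inter> B" and v: "v \<in> normal_cone x (A \<inter> B)"
  shows "v \<in> normal_cone x A + normal_cone x B"
proof -
  \<comment> \<open>\<open>C\<close> consists of the pairs \<open>(a - b, t)\<close> with \<open>t \<le> v \<bullet> a\<close>; the slack variable \<open>s\<close> presents it
    as a linear image, hence a convex set.\<close>
  define f :: "('a \<times> 'a) \<times> real \<Rightarrow> 'a \<times> real"
    where "f = (\<lambda>((a, b), s). (a - b, v \<bullet> a - s))"
  define C where "C = f ` ((A \<times> B) \<times> {0..})"
  have "linear f"
    by (intro linearI) (auto simp: f_def algebra_simps inner_add_right)
  then have "convex C"
    unfolding C_def using assms(1,2) by (intro convex_linear_image convex_Times) auto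
  have C_I: "(a - b, t) \<in> C" if "a \<in> A" "b \<in> B" "t \<le> v \<bullet> a" for a b t
    unfolding C_def using that
    by (intro image_eqI[where x = "((a, b), v \<bullet> a - t)"]) (auto simp: f_def)
  have C_E: "\<exists>a\<in>A. \<exists>b\<in>B. q = (a - b, snd q) \<and> snd q \<le> v \<bullet> a" if "q \<in> C" for q
    using that by (fastforce simp: C_def f_def)
  have in_C: "(0, t) \<in> C" if "t \<le> v \<bullet> x" for t
    using C_I[of x x t] x that by simp
  \<comment> \<open>Otherwise \<open>C\<close> would reach above \<open>(0, v \<bullet> x)\<close>, but over the origin \<open>a = b\<close> lies in \<open>A \<inter> B\<close>, where
    \<open>v\<close> is maximal at \<open>x\<close>.\<close>
  have "(0, v \<bullet> x) \<notin> rel_interior C"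
  proof
    assume "(0, v \<bullet> x) \<in> rel_interior C"
    moreover have "(0, v \<bullet> x - 1) \<in> affine hull C"
      by (intro hull_inc in_C) simp
    ultimately obtain e where e: "e > 1"
      "(1 - e) *\<^sub>R (0, v \<bullet> x - 1) + e *\<^sub>R (0, v \<bullet> x) \<in> C"
      using convex_rel_interior_if2[OF \<open>convex C\<close>] by blast
    then have "(0, v \<bullet> x + (e - 1)) \<in> C"
      by (simp add: algebra_simps)
    then obtain a where "a \<in> A \<inter> B" "v \<bullet> x + (e - 1) \<le> v \<bullet> a"
      using C_E by fastforce
    moreover have "v \<bullet> a \<le> v \<bullet> x"
      using v \<open>a \<in> A \<inter> B\<close> by (auto simp: normal_cone_def inner_diff_right)
    ultimately show False
      using e(1) by simp
  qed
  then obtain h where h: "\<And>q. q \<in> C \<Longrightarrow> h \<bullet> (0, v \<bullet> x) \<le> h \<bullet> q"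
    and strict: "\<And>q. q \<in> rel_interior C \<Longrightarrow> h \<bullet> (0, v \<bullet> x) < h \<bullet> q"
    using supporting_hyperplane_rel_boundary[OF \<open>convex C\<close> in_C] by blast
  obtain p' \<beta> where h_eq: "h = (p', \<beta>)"
    by (cases h)
  define p \<alpha> where "p = - p'" and "\<alpha> = - \<beta>"
  have sep: "p \<bullet> (a - b) + \<alpha> * t \<le> \<alpha> * (v \<bullet> x)" if "a \<in> A" "b \<in> B" "t \<le> v \<bullet> a" for a b t
    using h[OF C_I[OF that]] by (simp add: h_eq p_def \<alpha>_def)
  have "\<alpha> \<ge> 0"
    using sep[of x x "v \<bullet> x - 1"] x by (simp add: algebra_simps)
  have "\<alpha> \<noteq> 0"
  proof
    \<comment> \<open>A vertical hyperplane would separate \<open>A\<close> from \<open>B\<close> by \<open>p\<close>; the common relatively interior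
      point forces \<open>p\<close> to be constant on \<open>A \<union> B\<close>, so that the separation is not proper.\<close>
    assume "\<alpha> = 0"
    have le: "p \<bullet> a \<le> p \<bullet> b" if "a \<in> A" "b \<in> B" for a b
      using sep[OF that order_refl] \<open>\<alpha> = 0\<close> by (simp add: inner_diff_right)
    obtain c where c: "c \<in> rel_interior A" "c \<in> rel_interior B"
      using ri by blast
    then have "c \<in> A" "c \<in> B"
      using rel_interior_subset by blast+
    have A: "p \<bullet> a = p \<bullet> c" if "a \<in> A" for a
      using \<open>convex A\<close> c(1) le[OF _ \<open>c \<in> B\<close>] that
      by (rule inner_constant_if_max_at_rel_interior)
    have "(- p) \<bullet> b \<le> (- p) \<bullet> c" if "b \<in> B" for b
      using le[OF \<open>c \<in> A\<close> that] by simp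
    with \<open>convex B\<close> c(2) have "(- p) \<bullet> b = (- p) \<bullet> c" if "b \<in> B" for b
      using that by (rule inner_constant_if_max_at_rel_interior)
    then have B: "p \<bullet> b = p \<bullet> c" if "b \<in> B" for b
      using that by simp
    obtain q where q: "q \<in> rel_interior C"
      using rel_interior_eq_empty[OF \<open>convex C\<close>] in_C by blast
    then obtain a b where "a \<in> A" "b \<in> B" "q = (a - b, snd q)"
      using C_E rel_interior_subset by blast
    then have "p \<bullet> fst q = 0"
      using A[of a] B[of b] by (metis fst_conv inner_diff_right diff_self)
    then have "h \<bullet> q = 0"
      using \<open>\<alpha> = 0\<close> by (cases q) (simp add: h_eq p_def \<alpha>_def)
    then show False
      using strict[OF q] \<open>\<alpha> = 0\<close> by (simp add: h_eq \<alpha>_def)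
  qed
  with \<open>\<alpha> \<ge> 0\<close> have "\<alpha> > 0"
    by simp
  define r where "r = (1 / \<alpha>) *\<^sub>R p"
  have r: "r \<bullet> (a - b) + v \<bullet> (a - x) \<le> 0" if "a \<in> A" "b \<in> B" for a b
  proof -
    have "\<alpha> * (r \<bullet> (a - b) + v \<bullet> (a - x)) = p \<bullet> (a - b) + \<alpha> * (v \<bullet> a) - \<alpha> * (v \<bullet> x)"
      using \<open>\<alpha> > 0\<close> by (simp add: r_def field_simps inner_diff_right)
    also have "\<dots> \<le> 0"
      using sep[OF that order_refl] by simp
    finally show ?thesis
      using \<open>\<alpha> > 0\<close> by (simp add: mult_le_0_iff)
  qed
  have "v + r \<in> normal_cone x A"
    using r[of _ x] x by (auto simp: normal_cone_def inner_add_left add.commute)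
  moreover have "- r \<in> normal_cone x B"
    using r[of x] x by (auto simp: normal_cone_def inner_diff_right)
  ultimately have "(v + r) + (- r) \<in> normal_cone x A + normal_cone x B"
    by (rule set_plus_intro)
  then show ?thesis
    by simp
qed

lemma normal_cone_Int:
  fixes A B :: "'a::euclidean_space set"
  assumes "convex A" "convex B" "rel_interior A \<inter> rel_interior B \<noteq> {}" "x \<in> A \<inter> B"
  shows "normal_cone x (A \<inter> B) = normal_cone x A + normal_cone x B"
proof
  show "normal_cone x (A \<inter> B) \<subseteq> normal_cone x A + normal_cone x B"
    using normal_cone_Int_subset[OF assms] by blast
  show "normal_cone x A + normal_cone x B \<subseteq> normal_cone x (A \<inter> B)"
    by (auto simp: set_plus_def normal_cone_def inner_add_left intro!: add_nonpos_nonpos)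
qed

text \<open>The point \<open>z\<close> is arbitrary: the zero last component makes every normal condition on \<open>\<Omega>\<close>
  independent of the fibre coordinate.\<close>

lemma normal_cone_fst_image:
  "u \<in> normal_cone x (fst ` \<Omega>) \<longleftrightarrow> (u, 0) \<in> normal_cone (x, z) \<Omega>"
  by (auto simp: normal_cone_def)

lemma gph_neg_map:
  "gph (neg_map G) = (\<lambda>(x, z). (x, - z)) ` gph G"
  by (auto simp: gph_def neg_map_def image_iff)

lemma convex_gph_neg_map:
  fixes G :: "'a::real_vector \<Rightarrow> 'b::real_vector set"
  assumes "convex (gph G)"
  shows "convex (gph (neg_map G))"
  unfolding gph_neg_map using assms
  by (intro convex_linear_image linearI) auto

lemma normal_cone_gph_neg_map:
  "(r, w) \<in> normal_cone (x, z) (gph (neg_map G)) \<longleftrightarrow> (r, - w) \<in> normal_cone (x, - z) (gph G)"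
proof -
  have "w \<bullet> (- c - z) = - w \<bullet> (c + z)" for c
    by (simp add: algebra_simps)
  then show ?thesis
    by (auto simp: normal_cone_def gph_neg_map)
qed

lemma gph_solution_map:
  "gph (solution_map F G) = fst ` (gph F \<inter> gph (neg_map G))"
proof -
  have "0 \<in> A + B \<longleftrightarrow> (\<exists>z\<in>A. z \<in> uminus ` B)" for A B :: "'c::ab_group_add set"
    by (auto simp: set_plus_def image_iff eq_neg_iff_add_eq_0)
  then show ?thesis
    by (force simp: gph_def solution_map_def neg_map_def image_iff)
qed

theorem theorem12p2:
  fixes F G :: "(real ^ 'n) \<times> (real ^ 'p) \<Rightarrow> (real ^ 'q) set"
    and xbar :: "real ^ 'n" and ybar :: "real ^ 'p"
  assumes "convex (gph F)" and "convex (gph G)"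
    and "(xbar, ybar) \<in> gph (solution_map F G)"
    and "rel_interior (gph F) \<inter> rel_interior (gph (neg_map G)) \<noteq> {}"
  shows "\<forall>zbar \<in> F (xbar, ybar) \<inter> neg_map G (xbar, ybar). \<forall>v :: real ^ 'p.
    coderivative (solution_map F G) (xbar, ybar) v =
      (\<Union>w. {u. (u, - v) \<in> coderivative F ((xbar, ybar), zbar) w
                        + coderivative G ((xbar, ybar), - zbar) w})"
proof (intro ballI allI set_eqI)
  fix zbar v u
  assume zbar: "zbar \<in> F (xbar, ybar) \<inter> neg_map G (xbar, ybar)"
  let ?p = "((xbar, ybar), zbar)"
  have mem: "?p \<in> gph F \<inter> gph (neg_map G)"
    using zbar by (simp add: gph_def)
  have "u \<in> coderivative (solution_map F G) (xbar, ybar) v \<longleftrightarrow>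
      ((u, - v), 0) \<in> normal_cone ?p (gph F \<inter> gph (neg_map G))"
    by (simp add: coderivative_def gph_solution_map normal_cone_fst_image[where z = zbar])
  also have "\<dots> \<longleftrightarrow> ((u, - v), 0) \<in> normal_cone ?p (gph F) + normal_cone ?p (gph (neg_map G))"
    using normal_cone_Int[OF assms(1) convex_gph_neg_map[OF assms(2)] assms(4) mem] by simp
  also have "\<dots> \<longleftrightarrow> (\<exists>w q r. (u, - v) = q + r \<and> (q, - w) \<in> normal_cone ?p (gph F) \<and>
      (r, w) \<in> normal_cone ?p (gph (neg_map G)))" (is "?L \<longleftrightarrow> ?R")
  proof
    assume ?L
    then obtain q s r t where *: "((u, - v), 0) = (q, s) + (r, t)"
      "(q, s) \<in> normal_cone ?p (gph F)" "(r, t) \<in> normal_cone ?p (gph (neg_map G))"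
      by (metis set_plus_elim surj_pair)
    then have "s = - t" and "(u, - v) = q + r"
      by (simp_all add: eq_neg_iff_add_eq_0)
    with * show ?R
      by blast
  next
    assume ?R
    then obtain w q r where *: "(u, - v) = q + r" "(q, - w) \<in> normal_cone ?p (gph F)"
      "(r, w) \<in> normal_cone ?p (gph (neg_map G))"
      by blast
    then have "((u, - v), 0) = (q, - w) + (r, w)"
      by simp
    with *(2,3) show ?L
      by (metis set_plus_intro)
  qed
  also have "\<dots> \<longleftrightarrow> u \<in> (\<Union>w. {u. (u, - v) \<in> coderivative F ?p w
      + coderivative G ((xbar, ybar), - zbar) w})"
    by (simp only: normal_cone_gph_neg_map coderivative_def set_plus_def UN_iff mem_Collect_eq
        bex_UNIV) blast
  finally show "u \<in> coderivative (solution_map F G) (xbar, ybar) v \<longleftrightarrow>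
      u \<in> (\<Union>w. {u. (u, - v) \<in> coderivative F ?p w
        + coderivative G ((xbar, ybar), - zbar) w})" .
qed

end
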